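(* Let $\mathcal F$ be a filter on $\omega$ such that there exists an injective $\mathcal F$-convergent sequence $(x_n)_{n\in\omega}$ in the Stone–Čech compactification $\beta\omega$ of the discrete space $\omega$. Then: (1) if $\mathcal F$ is a $P^+$-filter, then for some set $A\in\mathcal F^+$ the filter $\mathcal F|A=\{F\cap A:F\in\mathcal F\}$ on $A$ is an ultrafilter; (2) $\chi(\mathcal F)\ge\min\{\mathfrak d,\mathfrak u\}$; (3) $\mathcal F$ is not an analytic $P^+$-filter; (4) $\mathcal F$ is not an $F_\sigma$-filter.
   Context: For a filter $\mathcal F$ on $\omega$, a sequence $(x_n)_{n\in\omega}$ in a topological space is $\mathcal F$-convergent if there is a point $x_\infty$ of the space such that $\{n\in\omega:x_n\in O\}\in\mathcal F$ for each neighborhood $O$ of $x_\infty$; the sequence is injective if $x_n\ne x_m$ for all $n\ne m$. $\mathcal F^+=\{A\subset\omega:\forall F\in\mathcal F\ A\cap F\neq\emptyset\}$. An infinite set $A$ is a pseudointersection of a family $\mathcal C$ of sets if $A\setminus C$ is finite for every $C\in\mathcal C$. $\mathcal F$ is a $P^+$-filter if each countable subfamily $\mathcal C\subset\mathcal F$ has a pseudointersection $A\in\mathcal F^+$. $\mathcal F$ is analytic (resp. an $F_\sigma$-filter) if it is an analytic (resp. $F_\sigma$) subset of the power-set $\mathcal P(\omega)=2^\omega$ with its usual compact metrizable topology. The character $\chi(\mathcal F)$ is the smallest cardinality of a family $\mathcal B\subset\mathcal F$ such that $\mathcal F=\{F\subset\omega:\exists B\in\mathcal B\ B\subset F\}$.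 The ultrafilter number is $\mathfrak u=\min\{\chi(\mathcal U):\mathcal U\in\beta\omega\setminus\omega\}$, the minimum being over all free ultrafilters on $\omega$, and the dominating number $\mathfrak d$ is the smallest cardinality of a cofinal subset of the partially ordered set $(\omega^\omega,\le)$, where $\le$ is the pointwise order.
   Formalization: The filter is assumed free (its members have empty intersection); without this the claim fails, e.g. for the principal ultrafilter at 0, along which every sequence converges although its character is 1 and it is clopen in the power-set. *)

theory Defs
  imports "HOL-Analysis.Analysis"
begin

unbundle cardinal_syntax

section \<open>Filters as families of sets\<close>

definition filter_on :: "'a set \<Rightarrow> 'a set set \<Rightarrow> bool" where
  "filter_on X \<F> \<longleftrightarrow>
     \<F> \<subseteq> Pow X \<and> X \<in> \<F> \<and> {} \<notin> \<F> \<and>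
     (\<forall>A\<in>\<F>. \<forall>B\<in>\<F>. A \<inter> B \<in> \<F>) \<and>
     (\<forall>A\<in>\<F>. \<forall>B. A \<subseteq> B \<and> B \<subseteq> X \<longrightarrow> B \<in> \<F>)"

lemma filter_onI:
  assumes "\<And>A. A \<in> \<F> \<Longrightarrow> A \<subseteq> X" "X \<in> \<F>" "{} \<notin> \<F>"
    and "\<And>A B. A \<in> \<F> \<Longrightarrow> B \<in> \<F> \<Longrightarrow> A \<inter> B \<in> \<F>"
    and "\<And>A B. A \<in> \<F> \<Longrightarrow> A \<subseteq> B \<Longrightarrow> B \<subseteq> X \<Longrightarrow> B \<in> \<F>"
  shows "filter_on X \<F>"
  using assms by (auto simp: filter_on_def)

lemma filter_onD:
  assumes "filter_on X \<F>"
  shows "A \<in> \<F> \<Longrightarrow> A \<subseteq> X" and "X \<in> \<F>" and "{} \<notin> \<F>"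
    and "A \<in> \<F> \<Longrightarrow> B \<in> \<F> \<Longrightarrow> A \<inter> B \<in> \<F>"
    and "A \<in> \<F> \<Longrightarrow> A \<subseteq> B \<Longrightarrow> B \<subseteq> X \<Longrightarrow> B \<in> \<F>"
  using assms by (auto simp: filter_on_def)

definition ultrafilter_on :: "'a set \<Rightarrow> 'a set set \<Rightarrow> bool" where
  "ultrafilter_on X \<U> \<longleftrightarrow>
     filter_on X \<U> \<and> (\<forall>\<V>. filter_on X \<V> \<and> \<U> \<subseteq> \<V> \<longrightarrow> \<V> = \<U>)"

lemma ultrafilter_on_iff:
  "ultrafilter_on X \<U> \<longleftrightarrow> filter_on X \<U> \<and> (\<forall>A. A \<subseteq> X \<longrightarrow> A \<in> \<U> \<or> X - A \<in> \<U>)"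
proof (intro iffI conjI allI impI)
  assume u: "ultrafilter_on X \<U>"
  then show filt: "filter_on X \<U>" by (simp add: ultrafilter_on_def)
  fix A assume A: "A \<subseteq> X"
  show "A \<in> \<U> \<or> X - A \<in> \<U>"
  proof (rule ccontr)
    assume neg: "\<not> (A \<in> \<U> \<or> X - A \<in> \<U>)"
    define \<V> where "\<V> = {B. B \<subseteq> X \<and> (\<exists>U\<in>\<U>. U \<inter> A \<subseteq> B)}"
    have "U \<inter> A \<noteq> {}" if "U \<in> \<U>" for U
    proof
      assume "U \<inter> A = {}"
      then have "U \<subseteq> X - A" using that filt by (auto simp: filter_on_def)
      then show False using that neg filter_onD(5)[OF filt, of U "X - A"] by blast
    qed
    then have "{} \<notin> \<V>" by (auto simp: \<V>_def)
    moreover have "B \<inter> C \<in> \<V>" if BC: "B \<in> \<V>" "C \<in> \<V>" for B C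
    proof -
      obtain U V where "U \<in> \<U>" "U \<inter> A \<subseteq> B" "V \<in> \<U>" "V \<inter> A \<subseteq> C"
        using BC by (auto simp: \<V>_def)
      then have "U \<inter> V \<in> \<U>" "(U \<inter> V) \<inter> A \<subseteq> B \<inter> C" using filt by (auto simp: filter_on_def)
      then show ?thesis using BC unfolding \<V>_def by blast
    qed
    moreover have "X \<in> \<V>" using filt A by (auto simp: filter_on_def \<V>_def)
    moreover have "B \<subseteq> X" if "B \<in> \<V>" for B using that by (simp add: \<V>_def)
    moreover have "C \<in> \<V>" if "B \<in> \<V>" "B \<subseteq> C" "C \<subseteq> X" for B C
      using that unfolding \<V>_def by blast
    ultimately have "filter_on X \<V>" by (intro filter_onI)
    moreover have "\<U> \<subseteq> \<V>"
    proof
      fix U assume "U \<in> \<U>"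
      moreover then have "U \<subseteq> X" using filt by (auto simp: filter_on_def)
      ultimately show "U \<in> \<V>" by (auto simp: \<V>_def)
    qed
    moreover have "A \<in> \<V>" using filt A by (auto simp: filter_on_def \<V>_def)
    ultimately show False using u neg unfolding ultrafilter_on_def by metis
  qed
next
  assume *: "filter_on X \<U> \<and> (\<forall>A. A \<subseteq> X \<longrightarrow> A \<in> \<U> \<or> X - A \<in> \<U>)"
  have "\<V> \<subseteq> \<U>" if \<V>: "filter_on X \<V>" "\<U> \<subseteq> \<V>" for \<V>
  proof
    fix A assume A: "A \<in> \<V>"
    have "X - A \<notin> \<V>"
    proof
      assume "X - A \<in> \<V>"
      then have "A \<inter> (X - A) \<in> \<V>" using A \<V> filter_onD(4) by blast
      then show False using \<V> by (simp add: filter_on_def)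
    qed
    moreover have "A \<subseteq> X" using A \<V> by (auto simp: filter_on_def)
    ultimately show "A \<in> \<U>" using * \<V> by blast
  qed
  then show "ultrafilter_on X \<U>"
    unfolding ultrafilter_on_def using * by (meson subset_antisym)
qed

lemma ultrafilter_on_extends:
  assumes "filter_on X \<F>"
  obtains \<U> where "ultrafilter_on X \<U>" "\<F> \<subseteq> \<U>"
proof -
  define \<A> where "\<A> = {\<V>. filter_on X \<V> \<and> \<F> \<subseteq> \<V>}"
  have "\<exists>\<U>\<in>\<A>. \<forall>\<V>\<in>\<A>. \<U> \<subseteq> \<V> \<longrightarrow> \<V> = \<U>"
  proof (rule subset_Zorn_nonempty)
    show "\<A> \<noteq> {}" using assms by (auto simp: \<A>_def)
    fix \<C> assume ne: "\<C> \<noteq> {}" and chain: "subset.chain \<A> \<C>"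
    have sub: "\<C> \<subseteq> \<A>" using chain by (auto simp: subset.chain_def)
    have filt: "filter_on X \<V>" if "\<V> \<in> \<C>" for \<V> using that sub by (auto simp: \<A>_def)
    have "A \<inter> B \<in> \<Union>\<C>" if AB: "A \<in> \<Union>\<C>" "B \<in> \<Union>\<C>" for A B
    proof -
      obtain \<V> \<W> where *: "\<V> \<in> \<C>" "A \<in> \<V>" "\<W> \<in> \<C>" "B \<in> \<W>" using AB by blast
      have "\<V> \<subseteq> \<W> \<or> \<W> \<subseteq> \<V>" using chain * by (auto simp: subset.chain_def)
      then obtain \<Z> where "\<Z> \<in> \<C>" "A \<in> \<Z>" "B \<in> \<Z>" using * by blast
      moreover then have "A \<inter> B \<in> \<Z>" using filt[of \<Z>] by (simp add: filter_on_def)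
      ultimately show ?thesis by blast
    qed
    moreover have "B \<in> \<Union>\<C>" if AB: "A \<in> \<Union>\<C>" "A \<subseteq> B" "B \<subseteq> X" for A B
    proof -
      obtain \<V> where "\<V> \<in> \<C>" "A \<in> \<V>" using AB by blast
      moreover then have "B \<in> \<V>" using AB filter_onD(5)[OF filt, of \<V> A B] by blast
      ultimately show ?thesis by blast
    qed
    moreover have "A \<subseteq> X" if "A \<in> \<Union>\<C>" for A using that filter_onD(1)[OF filt] by blast
    moreover have "{} \<notin> \<Union>\<C>" using filter_onD(3)[OF filt] by blast
    moreover have "X \<in> \<Union>\<C>" using ne filter_onD(2)[OF filt] by blast
    ultimately have "filter_on X (\<Union>\<C>)" by (intro filter_onI)
    moreover have "\<F> \<subseteq> \<Union>\<C>" using ne sub by (auto simp: \<A>_def)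
    ultimately show "\<Union>\<C> \<in> \<A>" by (simp add: \<A>_def)
  qed
  then obtain \<U> where \<U>: "\<U> \<in> \<A>" and max: "\<And>\<V>. \<V> \<in> \<A> \<Longrightarrow> \<U> \<subseteq> \<V> \<Longrightarrow> \<V> = \<U>" by blast
  have "ultrafilter_on X \<U>"
    unfolding ultrafilter_on_def using \<U> max unfolding \<A>_def
    by (metis (mono_tags, lifting) mem_Collect_eq order_trans)
  moreover have "\<F> \<subseteq> \<U>" using \<U> by (simp add: \<A>_def)
  ultimately show thesis by (rule that)
qed

text \<open>Free filters are the standing setting: along the principal ultrafilter at a point every
  sequence converges, although that ultrafilter has character 1 and is closed in the power set.\<close>

definition free_filter :: "nat set set \<Rightarrow> bool" where
  "free_filter \<F> \<longleftrightarrow> filter_on UNIV \<F> \<and> \<Inter>\<F> = {}"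

lemma free_filter_iff_cofinite:
  "free_filter \<F> \<longleftrightarrow> filter_on UNIV \<F> \<and> (\<forall>A. finite (- A) \<longrightarrow> A \<in> \<F>)"
proof (intro iffI conjI allI impI)
  assume "free_filter \<F>"
  then have filt: "filter_on UNIV \<F>" and free: "\<Inter>\<F> = {}"
    unfolding free_filter_def by auto
  show "filter_on UNIV \<F>" by (fact filt)
  fix A :: "nat set"
  assume "finite (- A)"
  then have "- (- A) \<in> \<F>"
  proof (induction "- A" arbitrary: A rule: finite_induct)
    case empty
    then show ?case using filt by (auto simp: filter_on_def)
  next
    case (insert n B A)
    obtain C where C: "C \<in> \<F>" "n \<notin> C" using free by blast
    have "- (- (- B)) \<in> \<F>" using insert(3)[of "- B"] by simp
    then have "C \<inter> - B \<in> \<F>" using C filt by (auto simp: filter_on_def)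
    moreover have "C \<inter> - B \<subseteq> - (- A)" using C insert(4) by auto
    ultimately show ?case using filter_onD(5)[OF filt] by blast
  qed
  then show "A \<in> \<F>" by simp
next
  assume *: "filter_on UNIV \<F> \<and> (\<forall>A. finite (- A) \<longrightarrow> A \<in> \<F>)"
  have "- {n} \<in> \<F>" for n using * by simp
  then have "\<Inter>\<F> = {}" by blast
  then show "free_filter \<F>" using * unfolding free_filter_def by blast
qed

lemma free_ultrafilter_exists: "\<exists>\<U>. ultrafilter_on UNIV \<U> \<and> free_filter \<U>"
proof -
  have "filter_on UNIV {A :: nat set. finite (- A)}"
    by (rule filter_onI) (auto simp: Compl_Int intro: finite_subset[OF Compl_anti_mono])
  then obtain \<U> where "ultrafilter_on UNIV \<U>" "{A :: nat set. finite (- A)} \<subseteq> \<U>"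
    using ultrafilter_on_extends by metis
  then show ?thesis
    unfolding free_filter_iff_cofinite ultrafilter_on_def by blast
qed

definition positive_sets :: "nat set set \<Rightarrow> nat set set" where
  "positive_sets \<F> = {A. \<forall>F\<in>\<F>. A \<inter> F \<noteq> {}}"

definition filter_trace :: "'a set set \<Rightarrow> 'a set \<Rightarrow> 'a set set" where
  "filter_trace \<F> A = {F \<inter> A | F. F \<in> \<F>}"

definition pseudointersection :: "nat set \<Rightarrow> nat set set \<Rightarrow> bool" where
  "pseudointersection A \<C> \<longleftrightarrow> infinite A \<and> (\<forall>C\<in>\<C>. finite (A - C))"

definition P_plus_filter :: "nat set set \<Rightarrow> bool" where
  "P_plus_filter \<F> \<longleftrightarrow>
     (\<forall>\<C>. countable \<C> \<and> \<C> \<subseteq> \<F> \<longrightarrow> (\<exists>A \<in> positive_sets \<F>. pseudointersection A \<C>))"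


section \<open>The Stone-Cech compactification of the discrete space of natural numbers\<close>

text \<open>The points are all ultrafilters; the sets of ultrafilters containing a given set
  form a base of the topology.\<close>

definition beta_omega :: "nat set set topology" where
  "beta_omega = topology_generated_by {{\<U>. ultrafilter_on UNIV \<U> \<and> A \<in> \<U>} | A. True}"

lemma topspace_beta_omega: "topspace beta_omega = {\<U>. ultrafilter_on UNIV \<U>}"
proof -
  have "UNIV \<in> \<U>" if "ultrafilter_on (UNIV :: nat set) \<U>" for \<U>
    using that by (auto simp: ultrafilter_on_def filter_on_def)
  then show ?thesis
    unfolding beta_omega_def topology_generated_by_topspace by blast
qed

text \<open>As filters are closed under supersets, open neighborhoods suffice.\<close>

definition filter_convergent :: "nat set set \<Rightarrow> 'a topology \<Rightarrow> (nat \<Rightarrow> 'a) \<Rightarrow> bool" where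
  "filter_convergent \<F> X x \<longleftrightarrow>
     (\<forall>n. x n \<in> topspace X) \<and>
     (\<exists>l \<in> topspace X. \<forall>U. openin X U \<and> l \<in> U \<longrightarrow> {n. x n \<in> U} \<in> \<F>)"


section \<open>Descriptive complexity\<close>

definition powerset_topology :: "nat set topology" where
  "powerset_topology =
     pullback_topology UNIV (\<lambda>A n. n \<in> A)
       (product_topology (\<lambda>_. discrete_topology (UNIV :: bool set)) (UNIV :: nat set))"

definition baire_space :: "(nat \<Rightarrow> nat) topology" where
  "baire_space = product_topology (\<lambda>_. discrete_topology UNIV) UNIV"

definition analytic_in :: "'a topology \<Rightarrow> 'a set \<Rightarrow> bool" where
  "analytic_in X S \<longleftrightarrow>
     S = {} \<or> (\<exists>f. continuous_map baire_space X f \<and> f ` topspace baire_space = S)"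


section \<open>Cardinal characteristics\<close>

text \<open>A cardinal is represented by a well-order of minimal type, and is determined up to \<open>=o\<close>.\<close>

definition min_cardinal :: "'a rel set \<Rightarrow> 'a rel" where
  "min_cardinal R = (SOME r. r \<in> R \<and> (\<forall>r'\<in>R. r \<le>o r'))"

lemma min_cardinal:
  assumes "R \<noteq> {}" "\<And>r. r \<in> R \<Longrightarrow> Card_order r"
  shows "min_cardinal R \<in> R" "\<And>r. r \<in> R \<Longrightarrow> min_cardinal R \<le>o r"
proof -
  have "\<exists>r. r \<in> R \<and> (\<forall>r'\<in>R. r \<le>o r')"
    using exists_minim_Card_order[of R] assms by blast
  then have "min_cardinal R \<in> R \<and> (\<forall>r'\<in>R. min_cardinal R \<le>o r')"
    unfolding min_cardinal_def by (rule someI_ex)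
  then show "min_cardinal R \<in> R" "\<And>r. r \<in> R \<Longrightarrow> min_cardinal R \<le>o r" by auto
qed

text \<open>The two cardinals may live on different types, so both are copied into the sum type.\<close>

definition cmin :: "'a rel \<Rightarrow> 'b rel \<Rightarrow> ('a + 'b) rel" where
  "cmin r s = (if r \<le>o s then card_of (Inl ` Field r) else card_of (Inr ` Field s))"

lemma cmin_ordLeq_iff:
  assumes r: "Card_order r" and s: "Card_order s"
  shows "cmin r s \<le>o t \<longleftrightarrow> r \<le>o t \<or> s \<le>o t"
proof -
  have "card_of (Inl ` Field r :: ('a + 'b) set) =o card_of (Field r)"
    by (intro card_of_ordIsoI[THEN ordIso_symmetric, of Inl] inj_on_imp_bij_betw) auto
  then have 1: "card_of (Inl ` Field r :: ('a + 'b) set) =o r"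
    using r card_of_Field_ordIso ordIso_transitive by blast
  have "card_of (Inr ` Field s :: ('a + 'b) set) =o card_of (Field s)"
    by (intro card_of_ordIsoI[THEN ordIso_symmetric, of Inr] inj_on_imp_bij_betw) auto
  then have 2: "card_of (Inr ` Field s :: ('a + 'b) set) =o s"
    using s card_of_Field_ordIso ordIso_transitive by blast
  show ?thesis
  proof (cases "r \<le>o s")
    case True
    then have "cmin r s =o r" using 1 by (simp add: cmin_def)
    then show ?thesis
      using True by (meson ordIso_ordLeq_trans ordIso_symmetric ordLeq_transitive)
  next
    case False
    then have "cmin r s =o s" using 2 by (simp add: cmin_def)
    moreover have "s \<le>o r"
      using False r s by (meson card_order_on_well_order_on ordLeq_total)
    ultimately show ?thesis
      by (meson ordIso_ordLeq_trans ordIso_symmetric ordLeq_transitive)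
  qed
qed

definition filter_base :: "nat set set \<Rightarrow> nat set set \<Rightarrow> bool" where
  "filter_base \<B> \<F> \<longleftrightarrow> \<B> \<subseteq> \<F> \<and> \<F> = {F. \<exists>B\<in>\<B>. B \<subseteq> F}"

definition character :: "nat set set \<Rightarrow> nat set rel" where
  "character \<F> = min_cardinal {|\<B>| | \<B>. filter_base \<B> \<F>}"

lemma character:
  assumes "filter_on UNIV \<F>"
  shows "\<exists>\<B>. filter_base \<B> \<F> \<and> character \<F> = |\<B>|"
    and "filter_base \<B> \<F> \<Longrightarrow> character \<F> \<le>o |\<B>|"
    and "Card_order (character \<F>)"
proof -
  have "filter_base \<F> \<F>" using assms by (auto simp: filter_base_def filter_on_def)
  then have ne: "{|\<B>| | \<B>. filter_base \<B> \<F>} \<noteq> {}" by blast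
  have co: "Card_order r" if "r \<in> {|\<B>| | \<B>. filter_base \<B> \<F>}" for r
    using that by (auto simp: card_of_Card_order)
  note min = min_cardinal[OF ne co, folded character_def]
  show *: "\<exists>\<B>. filter_base \<B> \<F> \<and> character \<F> = |\<B>|" using min(1) by auto
  show "Card_order (character \<F>)" using * by (auto simp: card_of_Card_order)
  show "filter_base \<B> \<F> \<Longrightarrow> character \<F> \<le>o |\<B>|" using min(2) by blast
qed

definition ultrafilter_number :: "nat set rel" where
  "ultrafilter_number =
     min_cardinal {character \<U> | \<U>. ultrafilter_on UNIV \<U> \<and> free_filter \<U>}"

lemma ultrafilter_number:
  shows "\<exists>\<U>. ultrafilter_on UNIV \<U> \<and> free_filter \<U> \<and> ultrafilter_number = character \<U>"
    and "ultrafilter_on UNIV \<U> \<Longrightarrow> free_filter \<U> \<Longrightarrow> ultrafilter_number \<le>o character \<U>"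
    and "Card_order ultrafilter_number"
proof -
  let ?R = "{character \<U> | \<U>. ultrafilter_on UNIV \<U> \<and> free_filter \<U>}"
  have ne: "?R \<noteq> {}" using free_ultrafilter_exists by blast
  have co: "Card_order r" if "r \<in> ?R" for r
    using that character(3) by (auto simp: ultrafilter_on_def)
  note min = min_cardinal[OF ne co, folded ultrafilter_number_def]
  show "\<exists>\<U>. ultrafilter_on UNIV \<U> \<and> free_filter \<U> \<and> ultrafilter_number = character \<U>"
    using min(1) by auto
  show "Card_order ultrafilter_number" using min(1) by (rule co)
  show "ultrafilter_on UNIV \<U> \<Longrightarrow> free_filter \<U> \<Longrightarrow> ultrafilter_number \<le>o character \<U>"
    using min(2) by blast
qed

definition dominating_number :: "(nat \<Rightarrow> nat) rel" where
  "dominating_number = min_cardinal {|D| | D. \<forall>f. \<exists>g\<in>D. f \<le> g}"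

lemma dominating_number:
  fixes D :: "(nat \<Rightarrow> nat) set"
  shows "\<exists>D. (\<forall>f. \<exists>g\<in>D. f \<le> g) \<and> dominating_number = |D|"
    and "(\<And>f. \<exists>g\<in>D. f \<le> g) \<Longrightarrow> dominating_number \<le>o |D|"
    and "Card_order dominating_number"
proof -
  let ?R = "{|D| | D :: (nat \<Rightarrow> nat) set. \<forall>f. \<exists>g\<in>D. f \<le> g}"
  have "\<forall>f :: nat \<Rightarrow> nat. \<exists>g\<in>UNIV. f \<le> g" by blast
  then have ne: "?R \<noteq> {}" by blast
  have co: "Card_order r" if "r \<in> ?R" for r
    using that by (auto simp: card_of_Card_order)
  note min = min_cardinal[OF ne co, folded dominating_number_def]
  show *: "\<exists>D. (\<forall>f. \<exists>g\<in>D. f \<le> g) \<and> dominating_number = |D|" using min(1) by auto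
  show "Card_order dominating_number" using min(1) by (rule co)
  show "dominating_number \<le>o |D|" if "\<And>f. \<exists>g\<in>D. f \<le> g"
    by (rule min(2)) (use that in auto)
qed

end

theory Submission
  imports Defs
begin

text \<open>Along a positive pseudointersection \<open>A\<close> of suitable neighbourhood traces, the sequence is
  discrete, so its points with indices in \<open>A\<close> contain pairwise disjoint sets \<open>D n\<close>. For
  \<open>S \<subseteq> A\<close> the limit contains \<open>\<Union>n\<in>S. D n\<close> or its complement, and convergence puts \<open>S\<close> or
  \<open>A - S\<close> into the trace. A filter with a base of fewer than \<open>dominating_number\<close> sets is a \<open>P\<close>-plus filter:
  some function is not dominated by those that measure where base elements meet a sequence of filter
  sets. An \<open>F\<close>-sigma filter is one by compactness. Copied to the natural numbers along an
  enumeration of \<open>A\<close>, the trace is a free ultrafilter which is analytic or \<open>F\<close>-sigma if the filter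
  is. A free ultrafilter and its complement cannot be separated modulo meager sets, whereas disjoint
  analytic sets can, by Lusin's argument.\<close>

section \<open>Filters and ultrafilters on the natural numbers\<close>

lemma free_filter_UNIV: "free_filter \<F> \<Longrightarrow> filter_on UNIV \<F>"
  by (simp add: free_filter_def)

lemma free_filter_diff_finite:
  assumes "free_filter \<F>" "F \<in> \<F>" "finite K"
  shows "F - K \<in> \<F>"
proof -
  have "- K \<in> \<F>" using assms by (auto simp: free_filter_iff_cofinite)
  then show ?thesis
    using filter_onD(4)[OF free_filter_UNIV[OF assms(1)] assms(2)] by (metis Diff_eq)
qed

lemma free_filter_mem_infinite: "free_filter \<F> \<Longrightarrow> F \<in> \<F> \<Longrightarrow> infinite F"
  using free_filter_diff_finite[of \<F> F F] by (auto simp: free_filter_def filter_on_def)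

lemma positive_sets_diff_finite:
  assumes "free_filter \<F>" "A \<in> positive_sets \<F>" "finite K"
  shows "A - K \<in> positive_sets \<F>"
  unfolding positive_sets_def
proof (intro CollectI ballI)
  fix F assume "F \<in> \<F>"
  then have "A \<inter> (F - K) \<noteq> {}"
    using free_filter_diff_finite[OF assms(1) _ assms(3)] assms(2) by (simp add: positive_sets_def)
  then show "(A - K) \<inter> F \<noteq> {}" by blast
qed

lemma positive_sets_infinite:
  assumes "free_filter \<F>" "A \<in> positive_sets \<F>"
  shows "infinite A"
proof
  assume "finite A"
  then have "{} \<in> positive_sets \<F>" using positive_sets_diff_finite[OF assms, of A] by simp
  then show False using filter_onD(2)[OF free_filter_UNIV[OF assms(1)]]
    by (auto simp: positive_sets_def)
qed

lemma filter_on_INT: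
  assumes "filter_on UNIV \<F>" "finite I" "\<And>i. i \<in> I \<Longrightarrow> A i \<in> \<F>"
  shows "(\<Inter>i\<in>I. A i) \<in> \<F>"
  using assms(2,3)
  by (induction I) (use filter_onD[OF assms(1)] in auto)

lemma filter_on_superset: "filter_on UNIV \<F> \<Longrightarrow> A \<in> \<F> \<Longrightarrow> A \<subseteq> B \<Longrightarrow> B \<in> \<F>"
  using filter_onD(5) by blast

lemma ultrafilter_on_Compl_iff:
  assumes "ultrafilter_on UNIV \<U>"
  shows "- A \<in> \<U> \<longleftrightarrow> A \<notin> \<U>"
proof -
  have "A \<in> \<U> \<or> - A \<in> \<U>" and filt: "filter_on UNIV \<U>"
    using assms by (auto simp: ultrafilter_on_iff Compl_eq_Diff_UNIV)
  moreover have "\<not> (A \<in> \<U> \<and> - A \<in> \<U>)"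
    using filter_onD(3)[OF filt] filter_onD(4)[OF filt, of A "- A"] by auto
  ultimately show ?thesis by blast
qed

lemma ultrafilter_on_separate:
  assumes "ultrafilter_on UNIV \<U>" "ultrafilter_on UNIV \<V>" "\<U> \<noteq> \<V>"
  shows "\<exists>A. A \<in> \<U> \<and> A \<notin> \<V>"
  using assms unfolding ultrafilter_on_def by blast

text \<open>Testing convergence only on the basic open sets of \<open>beta_omega\<close> removes the
  topology; later arguments use only this combinatorial form.\<close>

lemma filter_convergent_beta_omegaD:
  assumes "filter_convergent \<F> beta_omega x"
  shows "ultrafilter_on UNIV (x n)"
    and "\<exists>l. ultrafilter_on UNIV l \<and> (\<forall>A\<in>l. {n. A \<in> x n} \<in> \<F>)"
proof -
  have x: "ultrafilter_on UNIV (x n)" for n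
    using assms by (auto simp: filter_convergent_def topspace_beta_omega)
  then show "ultrafilter_on UNIV (x n)" .
  obtain l where l: "ultrafilter_on UNIV l"
    and conv: "\<And>U. openin beta_omega U \<Longrightarrow> l \<in> U \<Longrightarrow> {n. x n \<in> U} \<in> \<F>"
    using assms by (auto simp: filter_convergent_def topspace_beta_omega)
  have "{n. A \<in> x n} \<in> \<F>" if "A \<in> l" for A
  proof -
    have "openin beta_omega {\<U>. ultrafilter_on UNIV \<U> \<and> A \<in> \<U>}"
      unfolding beta_omega_def by (rule topology_generated_by_Basis) blast
    from conv[OF this] show ?thesis using that l x by simp
  qed
  with l show "\<exists>l. ultrafilter_on UNIV l \<and> (\<forall>A\<in>l. {n. A \<in> x n} \<in> \<F>)" by blast
qed

section \<open>Convergent sequences along positive sets\<close>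

text \<open>The sets \<open>B n\<close> separate \<open>l\<close> from \<open>x n\<close>; along a pseudointersection of the sets
  \<open>{m. B n \<in> x m}\<close> the sequence is therefore discrete.\<close>

lemma P_plus_filter_discrete_subsequence:
  assumes F: "free_filter \<F>" "P_plus_filter \<F>" and x: "inj x"
    and l: "ultrafilter_on UNIV l" "\<And>A. A \<in> l \<Longrightarrow> {n. A \<in> x n} \<in> \<F>"
    and ux: "\<And>n. ultrafilter_on UNIV (x n)"
  shows "\<exists>A\<in>positive_sets \<F>. \<exists>D. (\<forall>n\<in>A. D n \<in> x n) \<and> disjoint_family_on D A"
proof -
  have fx: "filter_on UNIV (x n)" for n using ux by (simp add: ultrafilter_on_def)
  have "\<exists>B. B \<in> l \<and> (x n \<noteq> l \<longrightarrow> B \<notin> x n)" for n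
    using ultrafilter_on_separate[OF l(1) ux, of n] filter_onD(2) l(1)
    unfolding ultrafilter_on_def by metis
  then obtain B where B: "\<And>n. B n \<in> l" "\<And>n. x n \<noteq> l \<Longrightarrow> B n \<notin> x n" by metis
  have "range (\<lambda>n. {m. B n \<in> x m}) \<subseteq> \<F>" using l(2) B(1) by blast
  then obtain A0 where A0: "A0 \<in> positive_sets \<F>"
    "pseudointersection A0 (range (\<lambda>n. {m. B n \<in> x m}))"
    using F(2) unfolding P_plus_filter_def by (meson countableI_type countable_image)
  have "finite (x -` {l})" using x by (simp add: finite_vimageI)
  \<comment> \<open>By injectivity at most one term equals \<open>l\<close>; without its index,
    \<open>B n\<close> separates \<open>l\<close> from \<open>x n\<close> for every \<open>n\<close>
    in \<open>A\<close>.\<close>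
  define A where "A = A0 - x -` {l}"
  have A: "A \<in> positive_sets \<F>"
    unfolding A_def by (intro positive_sets_diff_finite F A0 \<open>finite (x -` {l})\<close>)
  define M where "M n = {m \<in> A. B n \<notin> x m} - {n}" for n
  have fin: "finite (M n)" for n
    by (rule finite_subset[of _ "A0 - {m. B n \<in> x m}"])
      (use A0(2) in \<open>auto simp: M_def A_def pseudointersection_def\<close>)
  have "\<exists>E. m \<noteq> n \<longrightarrow> E \<in> x n \<and> E \<notin> x m" for m n
    using ultrafilter_on_separate[OF ux ux] x by (metis injD)
  then obtain E where E: "\<And>m n. m \<noteq> n \<Longrightarrow> E m n \<in> x n \<and> E m n \<notin> x m" by metis
  \<comment> \<open>\<open>- B n\<close> excludes the terms with indices in \<open>A\<close> outside
    \<open>M n\<close>, apart from \<open>x n\<close>; the sets \<open>E m n\<close> exclude the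
    finite remainder.\<close>
  define G where "G n = - B n \<inter> (\<Inter>m\<in>M n. E m n)" for n
  have G1: "G n \<in> x n" if "n \<in> A" for n
    unfolding G_def
  proof (intro filter_onD(4)[OF fx] filter_on_INT[OF fx fin])
    show "- B n \<in> x n" using that B(2) by (auto simp: A_def ultrafilter_on_Compl_iff[OF ux])
    show "E m n \<in> x n" if "m \<in> M n" for m using that E by (auto simp: M_def)
  qed
  have G2: "G n \<notin> x m" if "m \<in> A" "m \<noteq> n" for m n
  proof (cases "m \<in> M n")
    case True
    then have "G n \<subseteq> E m n" by (auto simp: G_def)
    then show ?thesis using E[OF that(2)] filter_on_superset[OF fx] by blast
  next
    case False
    then have "- B n \<notin> x m" using that by (auto simp: M_def ultrafilter_on_Compl_iff[OF ux])
    moreover have "G n \<subseteq> - B n" by (auto simp: G_def)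
    ultimately show ?thesis using filter_on_superset[OF fx] by blast
  qed
  \<comment> \<open>Removing the earlier sets makes the family disjoint; for \<open>n\<close> in
    \<open>A\<close> nothing is lost, since \<open>x n\<close> contains \<open>- G k\<close> for
    each \<open>k < n\<close>.\<close>
  define D where "D n = G n \<inter> (\<Inter>k\<in>{..<n}. - G k)" for n
  have "D n \<in> x n" if "n \<in> A" for n
    unfolding D_def
  proof (intro filter_onD(4)[OF fx] filter_on_INT[OF fx])
    show "G n \<in> x n" by (rule G1[OF that])
    show "- G k \<in> x n" if "k \<in> {..<n}" for k
      using that G2[OF \<open>n \<in> A\<close>, of k] by (auto simp: ultrafilter_on_Compl_iff[OF ux])
  qed simp
  moreover have "disjoint_family_on D A"
    unfolding disjoint_family_on_def
  proof (intro ballI impI)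
    fix m n :: nat assume "m \<noteq> n"
    then show "D m \<inter> D n = {}" by (cases m n rule: linorder_cases) (auto simp: D_def)
  qed
  ultimately show ?thesis using A by blast
qed

text \<open>Disjointness of the sets \<open>D n\<close> lets every subset of \<open>A\<close> be
  read off the sequence, and the limit, being an ultrafilter, decides the corresponding union.
  Positivity of \<open>A\<close> keeps the empty set out of the trace.\<close>

lemma P_plus_filter_trace_ultrafilter:
  assumes F: "free_filter \<F>" "P_plus_filter \<F>"
    and x: "inj x" "filter_convergent \<F> beta_omega x"
  shows "\<exists>A \<in> positive_sets \<F>. ultrafilter_on A (filter_trace \<F> A)"
proof -
  obtain l where l: "ultrafilter_on UNIV l" "\<And>A. A \<in> l \<Longrightarrow> {n. A \<in> x n} \<in> \<F>"
    using filter_convergent_beta_omegaD(2)[OF x(2)] by blast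
  have ux: "ultrafilter_on UNIV (x n)" for n by (rule filter_convergent_beta_omegaD(1)[OF x(2)])
  have fx: "filter_on UNIV (x n)" for n using ux by (simp add: ultrafilter_on_def)
  have fF: "filter_on UNIV \<F>" by (rule free_filter_UNIV[OF F(1)])
  obtain A D where A: "A \<in> positive_sets \<F>" and D: "\<And>n. n \<in> A \<Longrightarrow> D n \<in> x n"
    and disj: "disjoint_family_on D A"
    using P_plus_filter_discrete_subsequence[OF F x(1) l ux] by blast
  have D_iff: "(\<Union>n\<in>S. D n) \<in> x m \<longleftrightarrow> m \<in> S" if "S \<subseteq> A" "m \<in> A" for S m
  proof
    show "(\<Union>n\<in>S. D n) \<in> x m" if "m \<in> S"
      using that by (intro filter_on_superset[OF fx D[OF \<open>m \<in> A\<close>]]) blast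
    show "m \<in> S" if U: "(\<Union>n\<in>S. D n) \<in> x m"
    proof (rule ccontr)
      assume "m \<notin> S"
      have "D m \<inter> D n = {}" if "n \<in> S" for n
        by (rule disjoint_family_onD[OF disj]) (use that \<open>m \<notin> S\<close> \<open>S \<subseteq> A\<close> \<open>m \<in> A\<close> in auto)
      then have "D m \<inter> (\<Union>n\<in>S. D n) = {}" by blast
      then show False
        using filter_onD(4)[OF fx D[OF \<open>m \<in> A\<close>] U] filter_onD(3)[OF fx] by metis
    qed
  qed
  have "filter_on A (filter_trace \<F> A)"
  proof (rule filter_onI)
    show "A \<in> filter_trace \<F> A" using filter_onD(2)[OF fF] by (auto simp: filter_trace_def)
    show "{} \<notin> filter_trace \<F> A" using A by (auto simp: filter_trace_def positive_sets_def)
  next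
    fix P Q assume "P \<in> filter_trace \<F> A" "Q \<in> filter_trace \<F> A"
    then obtain P' Q' where "P = P' \<inter> A" "Q = Q' \<inter> A" "P' \<in> \<F>" "Q' \<in> \<F>"
      by (auto simp: filter_trace_def)
    then have "P \<inter> Q = (P' \<inter> Q') \<inter> A" "P' \<inter> Q' \<in> \<F>" using filter_onD(4)[OF fF] by auto
    then show "P \<inter> Q \<in> filter_trace \<F> A" unfolding filter_trace_def by blast
  next
    fix P Q assume P: "P \<in> filter_trace \<F> A" "P \<subseteq> Q" "Q \<subseteq> A"
    then obtain P' where P': "P = P' \<inter> A" "P' \<in> \<F>" by (auto simp: filter_trace_def)
    then have "Q = (P' \<union> Q) \<inter> A" "P' \<union> Q \<in> \<F>"
      using P filter_on_superset[OF fF, of P' "P' \<union> Q"] by auto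
    then show "Q \<in> filter_trace \<F> A" unfolding filter_trace_def by blast
  qed (auto simp: filter_trace_def)
  moreover have "S \<in> filter_trace \<F> A \<or> A - S \<in> filter_trace \<F> A" if S: "S \<subseteq> A" for S
  proof (cases "(\<Union>n\<in>S. D n) \<in> l")
    case True
    have "S = {m. (\<Union>n\<in>S. D n) \<in> x m} \<inter> A" using D_iff[OF S] S by blast
    then show ?thesis using l(2)[OF True] unfolding filter_trace_def by blast
  next
    case False
    then have "- (\<Union>n\<in>S. D n) \<in> l" using ultrafilter_on_Compl_iff[OF l(1)] by blast
    from l(2)[OF this] have "{m. (\<Union>n\<in>S. D n) \<notin> x m} \<in> \<F>"
      by (simp only: ultrafilter_on_Compl_iff[OF ux])
    moreover have "A - S = {m. (\<Union>n\<in>S. D n) \<notin> x m} \<inter> A" using D_iff[OF S] by blast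
    ultimately show ?thesis unfolding filter_trace_def by blast
  qed
  ultimately show ?thesis using A unfolding ultrafilter_on_iff by blast
qed

text \<open>The second description of \<open>\<U>\<close> exhibits it as a continuous preimage of the filter, the first
  one as a continuous image.\<close>

lemma trace_ultrafilter_transfer:
  assumes F: "free_filter \<F>" and A: "A \<in> positive_sets \<F>"
    and u: "ultrafilter_on A (filter_trace \<F> A)"
  obtains e \<U> where "inj e" "ultrafilter_on UNIV \<U>" "free_filter \<U>"
    "\<U> = (\<lambda>F. e -` F) ` \<F>" "\<U> = {X. e ` X \<union> - range e \<in> \<F>}"
proof -
  have fF: "filter_on UNIV \<F>" by (rule free_filter_UNIV[OF F(1)])
  define e where "e = enumerate A"
  have "infinite A" by (rule positive_sets_infinite[OF F A])
  then have e: "inj e" "range e = A"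
    using bij_enumerate[of A] by (auto simp: e_def bij_betw_def)
  \<comment> \<open>The tested set is the largest one with preimage \<open>X\<close> under
    \<open>e\<close>, so by upward closure it is in the filter as soon as some member has this
    preimage.\<close>
  define \<U> where "\<U> = {X. e ` X \<union> - range e \<in> \<F>}"
  have eq: "\<U> = (\<lambda>F. e -` F) ` \<F>"
  proof (intro equalityI subsetI)
    fix X assume "X \<in> \<U>"
    moreover have "X = e -` (e ` X \<union> - range e)" using e(1) by (auto simp: inj_eq)
    ultimately show "X \<in> (\<lambda>F. e -` F) ` \<F>" unfolding \<U>_def by blast
  next
    fix X assume "X \<in> (\<lambda>F. e -` F) ` \<F>"
    then obtain F where F: "F \<in> \<F>" "X = e -` F" by blast
    have "F \<subseteq> e ` X \<union> - range e" using F(2) by auto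
    then show "X \<in> \<U>" unfolding \<U>_def using F(1) filter_on_superset[OF fF] by blast
  qed
  have trace: "F \<inter> A = e ` (e -` F)" for F unfolding e(2)[symmetric] by blast
  have filt: "filter_on UNIV \<U>"
  proof (rule filter_onI)
    show "UNIV \<in> \<U>" unfolding \<U>_def using filter_onD(2)[OF fF] by simp
    show "{} \<notin> \<U>" using A by (auto simp: \<U>_def e(2) positive_sets_def)
  next
    fix P Q assume "P \<in> \<U>" "Q \<in> \<U>"
    then obtain P' Q' where "P = e -` P'" "Q = e -` Q'" "P' \<in> \<F>" "Q' \<in> \<F>"
      unfolding eq by blast
    then show "P \<inter> Q \<in> \<U>" unfolding eq using filter_onD(4)[OF fF, of P' Q'] by blast
  next
    fix P Q assume "P \<in> \<U>" "P \<subseteq> Q"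
    then show "Q \<in> \<U>" unfolding \<U>_def
      using filter_on_superset[OF fF, of "e ` P \<union> - range e" "e ` Q \<union> - range e"] by blast
  qed auto
  have "X \<in> \<U> \<or> UNIV - X \<in> \<U>" for X
  proof -
    have "e ` X \<subseteq> A" using e(2) by auto
    then have "e ` X \<in> filter_trace \<F> A \<or> A - e ` X \<in> filter_trace \<F> A"
      using u by (simp add: ultrafilter_on_iff)
    moreover have "A - e ` X = e ` (- X)" 
      using image_set_diff[OF e(1), of UNIV X] e(2) by (simp add: Compl_eq_Diff_UNIV)
    ultimately have "\<exists>F\<in>\<F>. e ` X = F \<inter> A \<or> e ` (- X) = F \<inter> A"
      unfolding filter_trace_def by auto
    then obtain F where F: "F \<in> \<F>" "e ` X = F \<inter> A \<or> e ` (- X) = F \<inter> A" by blast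
    have "X = e -` F \<or> - X = e -` F"
      using F(2) unfolding trace inj_image_eq_iff[OF e(1)] .
    moreover have "e -` F \<in> \<U>" using F(1) unfolding eq by (rule imageI)
    ultimately show ?thesis by (auto simp: Compl_eq_Diff_UNIV)
  qed
  then have "ultrafilter_on UNIV \<U>" using filt by (auto simp: ultrafilter_on_iff)
  moreover have "free_filter \<U>"
    unfolding free_filter_iff_cofinite
  proof (intro conjI allI impI filt)
    fix X :: "nat set" assume "finite (- X)"
    then have "finite (- (e ` X \<union> - range e))"
      by (rule finite_subset[rotated, OF finite_imageI[of _ e]]) auto
    then show "X \<in> \<U>" using F unfolding \<U>_def free_filter_iff_cofinite by simp
  qed
  ultimately show thesis using that e(1) eq \<U>_def by blast
qed

section \<open>Constructing pseudointersections\<close>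

text \<open>Cut the \<open>n\<close>th set of a decreasing sequence down to a finite window starting
  at \<open>n\<close>; the union is almost contained in every set of the sequence. The hypothesis
  provides windows that make this union positive.\<close>

lemma P_plus_filterI:
  assumes F: "free_filter \<F>"
    and g: "\<And>C :: nat \<Rightarrow> nat set. range C \<subseteq> \<F> \<Longrightarrow>
      \<exists>g. \<forall>F\<in>\<F>. \<exists>n. F \<inter> C n \<inter> {n..<g n} \<noteq> {}"
  shows "P_plus_filter \<F>"
  unfolding P_plus_filter_def
proof (intro allI impI, elim conjE)
  fix \<C> assume \<C>: "countable \<C>" "\<C> \<subseteq> \<F>"
  have fF: "filter_on UNIV \<F>" by (rule free_filter_UNIV[OF F])
  \<comment> \<open>Adding \<open>UNIV\<close> allows an enumeration even if \<open>\<C>\<close> is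
    empty.\<close>
  define c where "c = from_nat_into (insert UNIV \<C>)"
  have c: "range c = insert UNIV \<C>" unfolding c_def using \<C>(1) by (intro range_from_nat_into) auto
  define C where "C n = (\<Inter>i\<in>{..n}. c i)" for n :: nat
  have "c i \<in> \<F>" for i using c \<C>(2) filter_onD(2)[OF fF] by (metis insert_iff rangeI subsetD)
  then have "range C \<subseteq> \<F>" by (auto simp: C_def intro!: filter_on_INT[OF fF])
  with g obtain g where g: "\<And>F. F \<in> \<F> \<Longrightarrow> \<exists>n. F \<inter> C n \<inter> {n..<g n} \<noteq> {}" by metis
  define A where "A = (\<Union>n. C n \<inter> {n..<g n})"
  have pos: "A \<in> positive_sets \<F>"
    using g unfolding A_def positive_sets_def by blast
  have "finite (A - K)" if K: "K \<in> \<C>" for K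
  proof -
    obtain k where k: "K = c k" using K c by (metis imageE insertI2)
    \<comment> \<open>Once \<open>k \<le> n\<close>, \<open>C n\<close> is contained in
      \<open>c k\<close>, so only windows with \<open>n < k\<close> contribute points outside
      \<open>c k\<close>.\<close>
    have "A - K \<subseteq> (\<Union>n<k. {n..<g n})"
    proof
      fix a assume "a \<in> A - K"
      then obtain n where n: "a \<in> C n" "a \<in> {n..<g n}" "a \<notin> c k" unfolding A_def k by blast
      then have "n < k" by (auto simp: C_def not_less[symmetric])
      then show "a \<in> (\<Union>n<k. {n..<g n})" using n(2) by blast
    qed
    then show ?thesis by (rule finite_subset) auto
  qed
  then have "pseudointersection A \<C>"
    using positive_sets_infinite[OF F pos] by (simp add: pseudointersection_def)
  then show "\<exists>A\<in>positive_sets \<F>. pseudointersection A \<C>" using pos by blast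
qed

lemma filter_base_mem_iff:
  assumes "filter_base \<B> \<F>"
  shows "F \<in> \<F> \<longleftrightarrow> (\<exists>B\<in>\<B>. B \<subseteq> F)"
proof -
  have "\<F> = {F. \<exists>B\<in>\<B>. B \<subseteq> F}" using assms by (simp only: filter_base_def)
  from arg_cong[OF this, of "\<lambda>S. F \<in> S"] show ?thesis by (simp only: mem_Collect_eq)
qed

text \<open>Each base element yields a function locating its first meeting with \<open>C n\<close>
  from \<open>n\<close> on. These functions are too few to dominate, and one that escapes them
  bounds the required windows.\<close>

lemma P_plus_filter_if_base_less_dominating:
  assumes F: "free_filter \<F>" and base: "filter_base \<B> \<F>"
    and less: "\<not> dominating_number \<le>o |\<B>|"
  shows "P_plus_filter \<F>"
proof (rule P_plus_filterI[OF F])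
  fix C :: "nat \<Rightarrow> nat set"
  assume C: "range C \<subseteq> \<F>"
  have fF: "filter_on UNIV \<F>" by (rule free_filter_UNIV[OF F])
  have ex: "\<exists>i. i \<in> B \<inter> C n \<inter> {n..}" if "B \<in> \<F>" for B n
  proof -
    have "B \<inter> C n \<in> \<F>" using that C filter_onD(4)[OF fF] by auto
    then have "infinite (B \<inter> C n)" by (rule free_filter_mem_infinite[OF F])
    then obtain i where "i \<ge> n" "i \<in> B \<inter> C n" by (meson infinite_nat_iff_unbounded_le)
    then show ?thesis by auto
  qed
  define f where "f B n = (LEAST i. i \<in> B \<inter> C n \<inter> {n..})" for B n
  have f: "f B n \<in> B \<inter> C n \<inter> {n..}" if "B \<in> \<F>" for B n
    unfolding f_def using ex[OF that] by (rule LeastI_ex)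
  \<comment> \<open>As the order is pointwise, not being dominated means being larger at some
    \<open>n\<close>; one such \<open>n\<close> per base element is enough.\<close>
  have "\<not> (\<forall>g. \<exists>h\<in>f ` \<B>. g \<le> h)"
    using dominating_number(2)[of "f ` \<B>"] card_of_image[of f \<B>] less ordLeq_transitive by blast
  then obtain g where g: "\<And>B. B \<in> \<B> \<Longrightarrow> \<exists>n. f B n < g n" by (auto simp: le_fun_def not_le)
  have "\<exists>n. F \<inter> C n \<inter> {n..<g n} \<noteq> {}" if mem: "F \<in> \<F>" for F
  proof -
    obtain B where B: "B \<in> \<B>" "B \<subseteq> F" 
      using iffD1[OF filter_base_mem_iff[OF base] mem] by blast
    then obtain n where "f B n < g n" using g by blast
    moreover have "B \<in> \<F>" using B base by (auto simp: filter_base_def)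
    ultimately have "f B n \<in> F \<inter> C n \<inter> {n..<g n}" using f[of B n] B(2) by auto
    then show ?thesis by blast
  qed
  then show "\<exists>g. \<forall>F\<in>\<F>. \<exists>n. F \<inter> C n \<inter> {n..<g n} \<noteq> {}" by blast
qed

text \<open>Serves to bound the character of the copied ultrafilter by that of the filter.\<close>

lemma filter_base_image_vimage:
  assumes "filter_base \<B> \<F>" "\<U> = (\<lambda>F. e -` F) ` \<F>" "filter_on UNIV \<U>"
  shows "filter_base ((\<lambda>F. e -` F) ` \<B>) \<U>"
  unfolding filter_base_def
proof (intro conjI equalityI subsetI)
  show "Y \<in> \<U>" if "Y \<in> (\<lambda>F. e -` F) ` \<B>" for Y
    using that assms(1,2) by (auto simp: filter_base_def)
next
  fix Y assume "Y \<in> \<U>"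
  then obtain F where F: "F \<in> \<F>" "Y = e -` F" unfolding assms(2) by blast
  obtain B where "B \<in> \<B>" "B \<subseteq> F" using iffD1[OF filter_base_mem_iff[OF assms(1)] F(1)] by blast
  then show "Y \<in> {F. \<exists>B\<in>(\<lambda>F. e -` F) ` \<B>. B \<subseteq> F}" using F by blast
next
  fix Y assume "Y \<in> {F. \<exists>B\<in>(\<lambda>F. e -` F) ` \<B>. B \<subseteq> F}"
  then obtain B where B: "B \<in> \<B>" "e -` B \<subseteq> Y" by blast
  then have "e -` B \<in> \<U>" using assms(1,2) by (auto simp: filter_base_def)
  then show "Y \<in> \<U>" using B(2) filter_on_superset[OF assms(3)] by blast
qed

section \<open>Baire category in the power set\<close>

text \<open>These are the basic clopen sets of the Cantor space; the category notions are phrased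
  through them rather than through \<open>powerset_topology\<close>.\<close>

definition cylinder :: "nat set \<Rightarrow> nat \<Rightarrow> nat set set" where
  "cylinder X n = {Y. \<forall>i<n. i \<in> Y \<longleftrightarrow> i \<in> X}"

lemma self_in_cylinder [simp]: "X \<in> cylinder X n"
  by (simp add: cylinder_def)

lemma cylinder_subset: "Y \<in> cylinder X n \<Longrightarrow> n \<le> m \<Longrightarrow> cylinder Y m \<subseteq> cylinder X n"
  by (auto simp: cylinder_def)

definition nowhere_dense :: "nat set set \<Rightarrow> bool" where
  "nowhere_dense N \<longleftrightarrow> (\<forall>X n. \<exists>Y\<in>cylinder X n. \<exists>m\<ge>n. cylinder Y m \<inter> N = {})"

definition meager :: "nat set set \<Rightarrow> bool" where
  "meager M \<longleftrightarrow> (\<exists>\<N>. countable \<N> \<and> (\<forall>N\<in>\<N>. nowhere_dense N) \<and> M \<subseteq> \<Union>\<N>)"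

lemma meager_subset: "meager M \<Longrightarrow> L \<subseteq> M \<Longrightarrow> meager L"
  unfolding meager_def by (meson subset_trans)

lemma nowhere_dense_imp_meager: "nowhere_dense N \<Longrightarrow> meager N"
  unfolding meager_def by (rule exI[of _ "{N}"]) auto

lemma meager_UN:
  assumes "countable I" "\<And>i. i \<in> I \<Longrightarrow> meager (M i)"
  shows "meager (\<Union>i\<in>I. M i)"
proof -
  have "\<forall>i\<in>I. \<exists>\<N>. countable \<N> \<and> (\<forall>N\<in>\<N>. nowhere_dense N) \<and> M i \<subseteq> \<Union>\<N>"
    using assms(2) by (simp add: meager_def)
  then obtain \<N> where \<N>:
    "\<And>i. i \<in> I \<Longrightarrow> countable (\<N> i) \<and> (\<forall>N\<in>\<N> i. nowhere_dense N) \<and> M i \<subseteq> \<Union>(\<N> i)"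
    by metis
  show ?thesis
    unfolding meager_def
  proof (intro exI conjI)
    show "countable (\<Union>i\<in>I. \<N> i)" using \<N> assms(1) by blast
    show "\<forall>N\<in>(\<Union>i\<in>I. \<N> i). nowhere_dense N" using \<N> by blast
    show "(\<Union>i\<in>I. M i) \<subseteq> \<Union>(\<Union>i\<in>I. \<N> i)"
    proof (rule UN_least)
      fix i assume i: "i \<in> I"
      then have "M i \<subseteq> \<Union>(\<N> i)" using \<N> by simp
      also have "\<dots> \<subseteq> \<Union>(\<Union>i\<in>I. \<N> i)" by (rule Union_mono) (use i in blast)
      finally show "M i \<subseteq> \<Union>(\<Union>i\<in>I. \<N> i)" .
    qed
  qed
qed

lemma meager_Un: "meager L \<Longrightarrow> meager M \<Longrightarrow> meager (L \<union> M)"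
  using meager_UN[of UNIV "\<lambda>b :: bool. if b then L else M"] by (simp add: UNIV_bool Un_commute)

text \<open>The Baire category theorem for the Cantor space: shrinking cylinders avoid the nowhere
  dense sets one after the other, and a common point of them lies in none.\<close>

theorem cylinder_not_meager: "\<not> meager (cylinder X n)"
proof
  assume "meager (cylinder X n)"
  then obtain \<N> where \<N>: "countable \<N>" "\<forall>N\<in>\<N>. nowhere_dense N" "cylinder X n \<subseteq> \<Union>\<N>"
    unfolding meager_def by blast
  have "\<N> \<noteq> {}" using \<N>(3) self_in_cylinder by blast
  define N where "N = from_nat_into \<N>"
  have N: "nowhere_dense (N k)" for k
    unfolding N_def using from_nat_into[OF \<open>\<N> \<noteq> {}\<close>] \<N>(2) by blast
  \<comment> \<open>A pair stands for a cylinder, \<open>Q\<close> shrinks it away from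
    \<open>N k\<close>, and \<open>k \<le> snd p\<close> makes the lengths tend to infinity.\<close>
  define P where "P k p \<longleftrightarrow> k \<le> snd p \<and> n \<le> snd p \<and> fst p \<in> cylinder X n"
    for k :: nat and p :: "nat set \<times> nat"
  define Q where "Q k p q \<longleftrightarrow>
      fst q \<in> cylinder (fst p) (snd p) \<and> snd p \<le> snd q \<and> cylinder (fst q) (snd q) \<inter> N k = {}"
    for k :: nat and p q :: "nat set \<times> nat"
  have step: "\<exists>q. P (Suc k) q \<and> Q k p q" if p: "P k p" for k p
  proof -
    obtain Y m where Y: "Y \<in> cylinder (fst p) (Suc (snd p))" "m \<ge> Suc (snd p)"
      "cylinder Y m \<inter> N k = {}"
      using N unfolding nowhere_dense_def by metis
    then have "P (Suc k) (Y, m) \<and> Q k p (Y, m)"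
      using p by (auto simp: P_def Q_def cylinder_def)
    then show ?thesis by blast
  qed
  have "P 0 (X, n)" by (simp add: P_def)
  then obtain p where p: "\<And>k. P k (p k)" "\<And>k. Q k (p k) (p (Suc k))"
    using dependent_nat_choice[of P Q] step by blast
  have mono: "fst (p j) \<in> cylinder (fst (p k)) (snd (p k)) \<and> snd (p k) \<le> snd (p j)"
    if "k \<le> j" for j k
    using that
  proof (induction rule: dec_induct)
    case (step j)
    then show ?case using p(2)[of j] by (auto simp: Q_def cylinder_def)
  qed simp
  \<comment> \<open>The cylinder of stage \<open>Suc i\<close> has length at least
    \<open>Suc i\<close>, so it fixes coordinate \<open>i\<close>, and later stages keep it.\<close>
  define Z where "Z = {i. i \<in> fst (p (Suc i))}"
  have Z: "Z \<in> cylinder (fst (p k)) (snd (p k))" for k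
    unfolding cylinder_def
  proof (intro CollectI allI impI)
    fix i assume i: "i < snd (p k)"
    have i': "i < snd (p (Suc i))" using p(1)[of "Suc i"] by (simp add: P_def)
    show "i \<in> Z \<longleftrightarrow> i \<in> fst (p k)"
    proof (cases "k \<le> Suc i")
      case True
      then show ?thesis using mono[OF True] i by (simp add: Z_def cylinder_def)
    next
      case False
      then show ?thesis using mono[of "Suc i" k] i' by (simp add: Z_def cylinder_def)
    qed
  qed
  have "Z \<notin> N k" for k using Z[of "Suc k"] p(2)[of k] by (auto simp: Q_def)
  moreover have "Z \<in> cylinder X n"
    using Z[of 0] p(1)[of 0] by (auto simp: P_def cylinder_def)
  ultimately show False
    using \<N>(3) range_from_nat_into[OF \<open>\<N> \<noteq> {}\<close> \<N>(1)] unfolding N_def by blast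
qed

text \<open>The Banach category theorem for the Cantor space. As there are only countably many
  cylinders, those in which \<open>A\<close> is meager contribute a meager set, and what they leave
  of \<open>cylinder X n\<close> is nowhere dense.\<close>

lemma meager_Int_cylinderI:
  assumes loc: "\<And>Y m. Y \<in> cylinder X n \<Longrightarrow> n \<le> m \<Longrightarrow>
    \<exists>Z\<in>cylinder Y m. \<exists>p\<ge>m. meager (A \<inter> cylinder Z p)"
  shows "meager (A \<inter> cylinder X n)"
proof -
  \<comment> \<open>Finite centres suffice, since a cylinder of length \<open>p\<close> depends on
    its centre only below \<open>p\<close>; this keeps \<open>T\<close> countable.\<close>
  define T where "T = {t \<in> {Z. finite Z} \<times> UNIV. meager (A \<inter> cylinder (fst t) (snd t))}"
  have "countable ({Z :: nat set. finite Z} \<times> (UNIV :: nat set))"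
    by (intro countable_SIGMA countable_Collect_finite) auto
  then have "countable T" unfolding T_def by (rule countable_subset[rotated]) blast
  define N where "N = cylinder X n - (\<Union>t\<in>T. cylinder (fst t) (snd t))"
  have "nowhere_dense N"
    unfolding nowhere_dense_def
  proof (intro allI)
    fix Y m
    show "\<exists>Z\<in>cylinder Y m. \<exists>p\<ge>m. cylinder Z p \<inter> N = {}"
    proof (cases "Y \<in> cylinder X n")
      case True
      then obtain Z p where Z: "Z \<in> cylinder Y (max m n)" "p \<ge> max m n" "meager (A \<inter> cylinder Z p)"
        using loc[OF True, of "max m n"] by auto
      have eq: "cylinder (Z \<inter> {..<p}) p = cylinder Z p" by (auto simp: cylinder_def)
      then have "(Z \<inter> {..<p}, p) \<in> T" using Z(3) by (simp add: T_def)
      then have "cylinder Z p \<subseteq> (\<Union>t\<in>T. cylinder (fst t) (snd t))"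
        by (rule SUP_upper2) (simp add: eq)
      then have "cylinder Z p \<inter> N = {}" unfolding N_def by blast
      moreover have "Z \<in> cylinder Y m" using Z(1) by (simp add: cylinder_def)
      moreover have "m \<le> p" using Z(2) by simp
      ultimately show ?thesis by blast
    next
      case False
      then have "cylinder Y (max m n) \<inter> cylinder X n = {}"
        unfolding cylinder_def disjoint_iff mem_Collect_eq by (metis less_max_iff_disj)
      then have "cylinder Y (max m n) \<inter> N = {}" unfolding N_def by blast
      then show ?thesis by (meson max.cobounded1 self_in_cylinder)
    qed
  qed
  moreover have "meager (\<Union>t\<in>T. A \<inter> cylinder (fst t) (snd t))"
    by (rule meager_UN[OF \<open>countable T\<close>]) (simp add: T_def)
  ultimately have "meager (N \<union> (\<Union>t\<in>T. A \<inter> cylinder (fst t) (snd t)))"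
    using meager_Un nowhere_dense_imp_meager by blast
  then show ?thesis by (rule meager_subset) (auto simp: N_def)
qed

text \<open>Symmetric difference with \<open>D\<close> is a translation of the Cantor group: an
  involution that maps cylinders to cylinders.\<close>

lemma meager_symm_diff_image:
  assumes "meager M"
  shows "meager (sym_diff D ` M)"
proof -
  have invol: "sym_diff D (sym_diff D X) = X" for X by blast
  have cyl: "sym_diff D Y \<in> cylinder (sym_diff D X) n" if "Y \<in> cylinder X n" for X Y n
    using that by (auto simp: cylinder_def)
  have nd: "nowhere_dense (sym_diff D ` N)" if N: "nowhere_dense N" for N
    unfolding nowhere_dense_def
  proof (intro allI)
    fix X n
    obtain Y m where Y: "Y \<in> cylinder (sym_diff D X) n" "m \<ge> n" "cylinder Y m \<inter> N = {}"
      using N unfolding nowhere_dense_def by metis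
    have "cylinder (sym_diff D Y) m \<inter> sym_diff D ` N = {}"
    proof (rule ccontr)
      assume "cylinder (sym_diff D Y) m \<inter> sym_diff D ` N \<noteq> {}"
      then obtain Z where Z: "Z \<in> N" "sym_diff D Z \<in> cylinder (sym_diff D Y) m" by blast
      from cyl[OF Z(2)] have "Z \<in> cylinder Y m" by (simp only: invol)
      then show False using Y(3) Z(1) by blast
    qed
    moreover have "sym_diff D Y \<in> cylinder X n" using cyl[OF Y(1)] by (simp only: invol)
    ultimately show "\<exists>Y\<in>cylinder X n. \<exists>m\<ge>n. cylinder Y m \<inter> sym_diff D ` N = {}"
      using Y(2) by blast
  qed
  obtain \<N> where \<N>: "countable \<N>" "\<forall>N\<in>\<N>. nowhere_dense N" "M \<subseteq> \<Union>\<N>"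
    using assms unfolding meager_def by blast
  show ?thesis
    unfolding meager_def
  proof (intro exI conjI)
    show "countable ((`) (sym_diff D) ` \<N>)" using \<N>(1) by (rule countable_image)
    show "\<forall>N\<in>(`) (sym_diff D) ` \<N>. nowhere_dense N" using \<N>(2) nd by simp
    show "sym_diff D ` M \<subseteq> \<Union>((`) (sym_diff D) ` \<N>)"
      using image_mono[OF \<N>(3)] by (simp only: image_Union)
  qed
qed

section \<open>Separation modulo meager sets\<close>

text \<open>Equivalent to having an open set that contains \<open>A\<close> up to a meager set and
  meets \<open>B\<close> in a meager set; the local form avoids choosing it.\<close>

definition category_separated :: "nat set set \<Rightarrow> nat set set \<Rightarrow> bool" where
  "category_separated A B \<longleftrightarrow>
    (\<forall>X n. \<exists>Y\<in>cylinder X n. \<exists>m\<ge>n. meager (A \<inter> cylinder Y m) \<or> meager (B \<inter> cylinder Y m))"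

text \<open>If some \<open>A i\<close> is not meager in a cylinder, localization gives a subcylinder
  in no part of which it is meager. Separation then makes every \<open>B j\<close> meager in densely
  many smaller cylinders, hence throughout by localization again.\<close>

lemma category_separated_UN:
  fixes A B :: "nat \<Rightarrow> nat set set"
  assumes sep: "\<And>i j. category_separated (A i) (B j)"
  shows "category_separated (\<Union>i. A i) (\<Union>j. B j)"
  unfolding category_separated_def
proof (intro allI)
  fix X n
  show "\<exists>Y\<in>cylinder X n. \<exists>m\<ge>n.
    meager ((\<Union>i. A i) \<inter> cylinder Y m) \<or> meager ((\<Union>j. B j) \<inter> cylinder Y m)"
  proof (cases "\<forall>i. meager (A i \<inter> cylinder X n)")
    case True
    then have "meager (\<Union>i. A i \<inter> cylinder X n)" by (intro meager_UN) auto
    then have "meager ((\<Union>i. A i) \<inter> cylinder X n)" by (rule meager_subset) blast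
    then show ?thesis using self_in_cylinder by blast
  next
    case False
    then obtain i where "\<not> meager (A i \<inter> cylinder X n)" by blast
    then obtain Y m where Y: "Y \<in> cylinder X n" "n \<le> m"
      and nm: "\<And>Z p. Z \<in> cylinder Y m \<Longrightarrow> m \<le> p \<Longrightarrow> \<not> meager (A i \<inter> cylinder Z p)"
      using meager_Int_cylinderI[of X n "A i"] by blast
    have "meager (B j \<inter> cylinder Y m)" for j
    proof (rule meager_Int_cylinderI)
      fix Z p assume Z: "Z \<in> cylinder Y m" "m \<le> p"
      obtain W q where W: "W \<in> cylinder Z p" "p \<le> q"
        "meager (A i \<inter> cylinder W q) \<or> meager (B j \<inter> cylinder W q)"
        using sep unfolding category_separated_def by metis
      moreover have "\<not> meager (A i \<inter> cylinder W q)"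
        using nm[of W q] W Z cylinder_subset by (meson order_trans subsetD)
      ultimately show "\<exists>W\<in>cylinder Z p. \<exists>q\<ge>p. meager (B j \<inter> cylinder W q)" by blast
    qed
    then have "meager (\<Union>j. B j \<inter> cylinder Y m)" by (intro meager_UN) auto
    then have "meager ((\<Union>j. B j) \<inter> cylinder Y m)" by (rule meager_subset) blast
    then show ?thesis using Y by blast
  qed
qed

text \<open>A cylinder longer than \<open>k\<close> decides membership of \<open>k\<close> for all
  its elements, so it misses one of the two sets.\<close>

lemma category_separated_coordinate:
  assumes "\<And>X Y. X \<in> A \<Longrightarrow> Y \<in> B \<Longrightarrow> (k \<in> X) = P \<and> (k \<in> Y) = (\<not> P)"
  shows "category_separated A B"
  unfolding category_separated_def
proof (intro allI)
  fix X n
  have "A \<inter> cylinder X (max n (Suc k)) = {} \<or> B \<inter> cylinder X (max n (Suc k)) = {}"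
  proof (rule ccontr)
    assume "\<not> ?thesis"
    then obtain Y Z where "Y \<in> A" "Z \<in> B" "Y \<in> cylinder X (max n (Suc k))"
      "Z \<in> cylinder X (max n (Suc k))" by blast
    then show False using assms(1)[of Y Z] by (auto simp: cylinder_def)
  qed
  moreover have "meager {}" unfolding meager_def by blast
  ultimately show "\<exists>Y\<in>cylinder X n. \<exists>m\<ge>n.
      meager (A \<inter> cylinder Y m) \<or> meager (B \<inter> cylinder Y m)"
    by (metis max.cobounded1 self_in_cylinder)
qed

text \<open>The argument is that of Lusin's separation theorem: if the ranges were not separated, then
  neither would be the images of two shrinking sequences of basic open sets of the Baire space.\<close>

lemma category_separated_ranges:
  fixes f g :: "(nat \<Rightarrow> nat) \<Rightarrow> nat set"
  assumes f: "\<And>x k. \<exists>n. \<forall>y. (\<forall>i<n. y i = x i) \<longrightarrow> (k \<in> f y \<longleftrightarrow> k \<in> f x)"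
    and g: "\<And>x k. \<exists>n. \<forall>y. (\<forall>i<n. y i = x i) \<longrightarrow> (k \<in> g y \<longleftrightarrow> k \<in> g x)"
    and ne: "\<And>x y. f x \<noteq> g y"
  shows "category_separated (range f) (range g)"
proof (rule ccontr)
  assume not: "\<not> category_separated (range f) (range g)"
  define N where "N x n = {y. \<forall>i<n. y i = x i}" for x :: "nat \<Rightarrow> nat" and n
  \<comment> \<open>Prescribing coordinate \<open>n\<close> splits a basic open set into countably
    many, so \<open>category_separated_UN\<close> passes a failure of separation on to one pair of
    pieces.\<close>
  have N_Suc: "N x n = (\<Union>j. N (x(n := j)) (Suc n))" for x n
  proof (intro equalityI subsetI)
    fix y assume "y \<in> N x n"
    then have "y \<in> N (x(n := y n)) (Suc n)" by (auto simp: N_def less_Suc_eq)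
    then show "y \<in> (\<Union>j. N (x(n := j)) (Suc n))" by blast
  qed (auto simp: N_def less_Suc_eq)
  define P where "P n p \<longleftrightarrow> \<not> category_separated (f ` N (fst p) n) (g ` N (snd p) n)" for n p
  define Q where "Q n p q \<longleftrightarrow> fst q \<in> N (fst p) n \<and> snd q \<in> N (snd p) n"
    for n and p q :: "(nat \<Rightarrow> nat) \<times> (nat \<Rightarrow> nat)"
  have step: "\<exists>q. P (Suc n) q \<and> Q n p q" if "P n p" for n p
  proof -
    have "f ` N (fst p) n = (\<Union>i. f ` N ((fst p)(n := i)) (Suc n))"
      "g ` N (snd p) n = (\<Union>j. g ` N ((snd p)(n := j)) (Suc n))"
      by (subst N_Suc, rule image_UN)+
    with that have "\<not> category_separated (\<Union>i. f ` N ((fst p)(n := i)) (Suc n))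
        (\<Union>j. g ` N ((snd p)(n := j)) (Suc n))"
      unfolding P_def by simp
    then obtain i j where "P (Suc n) ((fst p)(n := i), (snd p)(n := j))"
      using category_separated_UN[of "\<lambda>i. f ` N ((fst p)(n := i)) (Suc n)"
          "\<lambda>j. g ` N ((snd p)(n := j)) (Suc n)"]
      unfolding P_def fst_conv snd_conv by blast
    moreover have "Q n p ((fst p)(n := i), (snd p)(n := j))" by (simp add: Q_def N_def)
    ultimately show ?thesis by blast
  qed
  have "P 0 (\<lambda>_. 0, \<lambda>_. 0)" using not by (simp add: P_def N_def)
  then obtain p where p: "\<And>n. P n (p n)" "\<And>n. Q n (p n) (p (Suc n))"
    using dependent_nat_choice[of P Q] step by blast
  define x y where "x i = fst (p (Suc i)) i" and "y i = snd (p (Suc i)) i" for i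
  have mono: "fst (p m) \<in> N (fst (p n)) n \<and> snd (p m) \<in> N (snd (p n)) n" if "n \<le> m" for m n
    using that
  proof (induction rule: dec_induct)
    case (step m)
    then show ?case using p(2)[of m] by (auto simp: Q_def N_def)
  qed (simp add: N_def)
  have "x i = fst (p n) i \<and> y i = snd (p n) i" if "i < n" for i n
    using mono[of "Suc i" n] that by (simp add: x_def y_def N_def)
  then have Np: "N (fst (p n)) n = N x n" "N (snd (p n)) n = N y n" for n
    unfolding N_def by simp_all
  \<comment> \<open>The limit points have different images; by continuity, a coordinate telling
    these apart is constant near each point, so late pieces are separated after all.\<close>
  obtain k where k: "(k \<in> f x) \<noteq> (k \<in> g y)" using ne[of x y] by blast
  obtain m where m: "\<And>z. z \<in> N x m \<Longrightarrow> k \<in> f z \<longleftrightarrow> k \<in> f x"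
    using f[where x=x and k=k] unfolding N_def by blast
  obtain n where n: "\<And>z. z \<in> N y n \<Longrightarrow> k \<in> g z \<longleftrightarrow> k \<in> g y"
    using g[where x=y and k=k] unfolding N_def by blast
  have "category_separated (f ` N x (max m n)) (g ` N y (max m n))"
  proof (rule category_separated_coordinate[of _ _ k "k \<in> f x"])
    have sub: "N x (max m n) \<subseteq> N x m" "N y (max m n) \<subseteq> N y n" by (auto simp: N_def)
    fix X Y assume "X \<in> f ` N x (max m n)" "Y \<in> g ` N y (max m n)"
    then show "(k \<in> X) = (k \<in> f x) \<and> (k \<in> Y) = (\<not> k \<in> f x)" using m n k sub by blast
  qed
  then show False using p(1)[of "max m n"] by (simp add: P_def Np)
qed

text \<open>Complementing a set beyond the length of a cylinder preserves the cylinder and exchanges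
  a free ultrafilter with its complement.\<close>

theorem free_ultrafilter_not_category_separated:
  assumes u: "ultrafilter_on UNIV \<U>" and free: "free_filter \<U>"
  shows "\<not> category_separated \<U> (- \<U>)"
proof
  assume "category_separated \<U> (- \<U>)"
  then obtain Y m where Y: "meager (\<U> \<inter> cylinder Y m) \<or> meager (- \<U> \<inter> cylinder Y m)"
    unfolding category_separated_def by blast
  define \<phi> where "\<phi> = sym_diff {m..}"
  have invol: "\<phi> (\<phi> X) = X" for X unfolding \<phi>_def by blast
  have cyl: "\<phi> X \<in> cylinder Y m \<longleftrightarrow> X \<in> cylinder Y m" for X
    unfolding \<phi>_def cylinder_def by auto
  have swap: "\<phi> X \<in> \<U> \<longleftrightarrow> X \<notin> \<U>" for X
  proof -
    have fin: "Q \<in> \<U>" if "P \<in> \<U>" "P - {..<m} \<subseteq> Q" for P Q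
      using that free_filter_diff_finite[OF free, of P "{..<m}"]
        filter_on_superset[OF free_filter_UNIV[OF free]] by blast
    \<comment> \<open>\<open>\<phi> X\<close> and \<open>- X\<close> agree from \<open>m\<close> on,
      and a free filter does not see finite changes.\<close>
    have "\<phi> X \<in> \<U> \<longleftrightarrow> - X \<in> \<U>"
      using fin[of "\<phi> X" "- X"] fin[of "- X" "\<phi> X"] by (fastforce simp: \<phi>_def)
    then show ?thesis using ultrafilter_on_Compl_iff[OF u] by blast
  qed
  have mgr: "meager B" if "meager A" "\<And>X. X \<in> B \<Longrightarrow> \<phi> X \<in> A" for A B
  proof (rule meager_subset)
    show "meager (\<phi> ` A)" unfolding \<phi>_def by (rule meager_symm_diff_image[OF that(1)])
    show "B \<subseteq> \<phi> ` A" using that(2) invol by (metis image_eqI subsetI)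
  qed
  have "meager (\<U> \<inter> cylinder Y m) \<longleftrightarrow> meager (- \<U> \<inter> cylinder Y m)"
    by (intro iffI; erule mgr; simp add: cyl swap)
  then have "meager ((\<U> \<inter> cylinder Y m) \<union> (- \<U> \<inter> cylinder Y m))" using Y meager_Un by blast
  then have "meager (cylinder Y m)" by (rule meager_subset) blast
  then show False using cylinder_not_meager by blast
qed

section \<open>Descriptive complexity of free ultrafilters\<close>

text \<open>A basic open set of the product restricts finitely many coordinates, all within an
  initial segment. Used for both the Baire space and the power set.\<close>

lemma openin_sequence_space_initial_segment:
  fixes x :: "nat \<Rightarrow> 'b"
  assumes "openin (product_topology (\<lambda>_. discrete_topology UNIV) UNIV) U" "x \<in> U"
  shows "\<exists>n. \<forall>y. (\<forall>i<n. y i = x i) \<longrightarrow> y \<in> U"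
proof -
  obtain V where V: "finite {i. V i \<noteq> UNIV}" "x \<in> PiE UNIV V" "PiE UNIV V \<subseteq> U"
    using assms unfolding openin_product_topology_alt by auto
  then obtain n where n: "\<And>i. V i \<noteq> UNIV \<Longrightarrow> i < n"
    using finite_nat_set_iff_bounded[of "{i. V i \<noteq> UNIV}"] by auto
  have "y \<in> U" if "\<forall>i<n. y i = x i" for y
  proof -
    have "y i \<in> V i" for i
      using that n[of i] V(2) by (cases "i < n") (auto simp: PiE_def Pi_def)
    then show ?thesis using V(3) by auto
  qed
  then show ?thesis by blast
qed

lemma openin_powerset_topology_cylinder:
  assumes "openin powerset_topology U" "X \<in> U"
  shows "\<exists>n. cylinder X n \<subseteq> U"
proof -
  obtain V where V: "openin (product_topology (\<lambda>_. discrete_topology UNIV) UNIV) V"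
    "U = (\<lambda>A n. n \<in> A) -` V"
    using assms(1) unfolding powerset_topology_def openin_pullback_topology by auto
  then obtain n where n: "\<And>y. (\<forall>i<n. y i = (i \<in> X)) \<Longrightarrow> y \<in> V"
    using openin_sequence_space_initial_segment[OF V(1), of "\<lambda>n. n \<in> X"] assms(2) by auto
  have "cylinder X n \<subseteq> U" using n unfolding V(2) cylinder_def by auto
  then show ?thesis by blast
qed

lemma topspace_powerset_topology [simp]: "topspace powerset_topology = UNIV"
  by (simp add: powerset_topology_def topspace_pullback_topology)

lemma openin_powerset_coordinate:
  "openin powerset_topology {A. k \<in> A}" "openin powerset_topology {A. k \<notin> A}"
proof -
  have "continuous_map powerset_topology (discrete_topology UNIV) (\<lambda>A. k \<in> A)"
    using continuous_map_compose[OF continuous_map_pullback[OF continuous_map_id]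
        continuous_map_product_projection[of k UNIV "\<lambda>_. discrete_topology (UNIV :: bool set)"]]
    unfolding powerset_topology_def by (simp add: comp_def)
  then have "openin powerset_topology {A \<in> topspace powerset_topology. (k \<in> A) \<in> S}" for S
    by (rule openin_continuous_map_preimage) simp
  from this[of "{True}"] this[of "{False}"]
  show "openin powerset_topology {A. k \<in> A}" "openin powerset_topology {A. k \<notin> A}" by simp_all
qed

text \<open>Tychonoff's theorem, carried to sets by the continuous surjection
  \<open>Collect\<close>.\<close>

lemma compact_space_powerset_topology: "compact_space powerset_topology"
proof -
  let ?T = "product_topology (\<lambda>_. discrete_topology (UNIV :: bool set)) (UNIV :: nat set)"
  have "compact_space ?T"
    by (auto simp: compact_space_product_topology compact_space_discrete_topology)
  moreover have "continuous_map ?T powerset_topology Collect"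
    unfolding powerset_topology_def
    by (rule continuous_map_pullback') (auto simp: comp_def)
  ultimately have "compactin powerset_topology (Collect ` topspace ?T)"
    unfolding compact_space_def by (rule image_compactin)
  moreover have "Collect ` topspace ?T = (UNIV :: nat set set)"
    using surjI[of Collect "\<lambda>A i. i \<in> A"] by simp
  ultimately show ?thesis by (simp add: compact_space_def)
qed

text \<open>Complementation is continuous and maps the ultrafilter onto its complement, so both
  would be continuous images of the Baire space, hence separated. The hypothesis on \<open>h\<close>
  is continuity in coordinates.\<close>

theorem free_ultrafilter_not_continuous_image:
  assumes u: "ultrafilter_on UNIV \<U>" "free_filter \<U>"
    and h: "\<And>x k. \<exists>n. \<forall>y. (\<forall>i<n. y i = x i) \<longrightarrow> (k \<in> h y \<longleftrightarrow> k \<in> h x)"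
  shows "\<U> \<noteq> range (h :: (nat \<Rightarrow> nat) \<Rightarrow> nat set)"
proof
  assume U: "\<U> = range h"
  have "- \<U> = range (\<lambda>x. - h x)"
  proof (intro equalityI subsetI)
    fix X assume "X \<in> - \<U>"
    then have "- X \<in> range h" unfolding U[symmetric] ultrafilter_on_Compl_iff[OF u(1)] by simp
    then obtain x where "- X = h x" by (rule rangeE)
    then have "X = - h x" by (metis double_complement)
    then show "X \<in> range (\<lambda>x. - h x)" by simp
  next
    fix X assume "X \<in> range (\<lambda>x. - h x)"
    then have "- X \<in> \<U>" using U by auto
    then show "X \<in> - \<U>" by (simp add: ultrafilter_on_Compl_iff[OF u(1)])
  qed
  moreover have "category_separated (range h) (range (\<lambda>x. - h x))"
  proof (rule category_separated_ranges)
    show "h x \<noteq> - h y" for x y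
      using ultrafilter_on_Compl_iff[OF u(1), of "h y"] U by (metis rangeI)
    show "\<exists>n. \<forall>y. (\<forall>i<n. y i = x i) \<longrightarrow> (k \<in> - h y \<longleftrightarrow> k \<in> - h x)" for x k
      using h by simp
  qed (rule h)
  ultimately show False using free_ultrafilter_not_category_separated[OF u] U by simp
qed

lemma analytic_in_powerset_topologyD:
  assumes "analytic_in powerset_topology S" "S \<noteq> {}"
  shows "\<exists>h :: (nat \<Rightarrow> nat) \<Rightarrow> nat set. S = range h \<and>
    (\<forall>x k. \<exists>n. \<forall>y. (\<forall>i<n. y i = x i) \<longrightarrow> (k \<in> h y \<longleftrightarrow> k \<in> h x))"
proof -
  obtain h where h: "continuous_map baire_space powerset_topology h"
    and "h ` topspace baire_space = S"
    using assms unfolding analytic_in_def by blast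
  have top: "topspace baire_space = UNIV" by (simp add: baire_space_def)
  have "\<exists>n. \<forall>y. (\<forall>i<n. y i = x i) \<longrightarrow> (k \<in> h y \<longleftrightarrow> k \<in> h x)" for x k
  proof -
    have "openin powerset_topology {A. k \<in> A \<longleftrightarrow> k \<in> h x}"
      using openin_powerset_coordinate[of k] by (cases "k \<in> h x") auto
    from openin_continuous_map_preimage[OF h this]
    have "openin baire_space {y. k \<in> h y \<longleftrightarrow> k \<in> h x}" by (simp add: top)
    then show ?thesis
      unfolding baire_space_def
      by (drule_tac openin_sequence_space_initial_segment[where x=x]) auto
  qed
  then show ?thesis using \<open>h ` topspace baire_space = S\<close> top by blast
qed

lemma fsigma_in_powerset_topologyD:
  assumes "fsigma_in powerset_topology S" "S \<noteq> {}"
  shows "\<exists>K :: nat \<Rightarrow> nat set set. S = (\<Union>n. K n) \<and> (\<forall>n. closedin powerset_topology (K n))"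
proof -
  obtain \<K> where \<K>: "countable \<K>" "\<And>K. K \<in> \<K> \<Longrightarrow> closedin powerset_topology K" "\<Union>\<K> = S"
    using assms(1) unfolding fsigma_in_def union_of_def by auto
  then have "\<K> \<noteq> {}" using assms(2) by blast
  show ?thesis
  proof (intro exI conjI allI)
    show "S = (\<Union>n. from_nat_into \<K> n)"
      using \<K>(3) range_from_nat_into[OF \<open>\<K> \<noteq> {}\<close> \<K>(1)] by simp
    show "closedin powerset_topology (from_nat_into \<K> n)" for n
      using \<K>(2) from_nat_into[OF \<open>\<K> \<noteq> {}\<close>] by blast
  qed
qed

text \<open>Each closed piece \<open>K n\<close> is compact, and all its elements meet
  \<open>C n\<close> from \<open>n\<close> on; finitely many meeting points serve the whole piece
  and give a window for each \<open>n\<close>.\<close>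

lemma P_plus_filter_if_fsigma:
  assumes F: "free_filter \<F>" and fs: "fsigma_in powerset_topology \<F>"
  shows "P_plus_filter \<F>"
proof (rule P_plus_filterI[OF F])
  fix C :: "nat \<Rightarrow> nat set"
  assume C: "range C \<subseteq> \<F>"
  have fF: "filter_on UNIV \<F>" by (rule free_filter_UNIV[OF F])
  have "\<F> \<noteq> {}" using filter_onD(2)[OF fF] by blast
  then obtain K :: "nat \<Rightarrow> nat set set" where K: "\<F> = (\<Union>n. K n)" "\<And>n. closedin powerset_topology (K n)"
    using fsigma_in_powerset_topologyD[OF fs] by blast
  have "\<exists>m. \<forall>F\<in>K n. F \<inter> C n \<inter> {n..<m} \<noteq> {}" for n
  proof -
    have "K n \<subseteq> (\<Union>k\<in>C n \<inter> {n..}. {A. k \<in> A})"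
    proof
      fix F assume "F \<in> K n"
      then have "F \<inter> C n \<in> \<F>" using K(1) C filter_onD(4)[OF fF] by blast
      then have "infinite (F \<inter> C n)" by (rule free_filter_mem_infinite[OF F])
      then obtain k where "k \<ge> n" "k \<in> F \<inter> C n" by (meson infinite_nat_iff_unbounded_le)
      then show "F \<in> (\<Union>k\<in>C n \<inter> {n..}. {A. k \<in> A})" by auto
    qed
    moreover have "compactin powerset_topology (K n)"
      using closedin_compact_space[OF compact_space_powerset_topology K(2)] .
    ultimately obtain \<G> where \<G>: "finite \<G>" "\<G> \<subseteq> (\<lambda>k. {A. k \<in> A}) ` (C n \<inter> {n..})" "K n \<subseteq> \<Union>\<G>"
      using openin_powerset_coordinate(1)
      unfolding compactin_def by (metis (no_types, lifting) imageE)
    then obtain S where S: "finite S" "S \<subseteq> C n \<inter> {n..}" "\<G> = (\<lambda>k. {A. k \<in> A}) ` S"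
      using finite_subset_image by metis
    obtain m where m: "\<And>k. k \<in> S \<Longrightarrow> k < m" using S(1) finite_nat_set_iff_bounded[of S] by blast
    have "F \<inter> C n \<inter> {n..<m} \<noteq> {}" if F: "F \<in> K n" for F
    proof -
      obtain k where "k \<in> S" "k \<in> F" using F \<G>(3) S(3) by blast
      then have "k \<in> F \<inter> C n \<inter> {n..<m}" using S(2) m by auto
      then show ?thesis by blast
    qed
    then show ?thesis by blast
  qed
  then obtain g where "\<And>n. \<forall>F\<in>K n. F \<inter> C n \<inter> {n..<g n} \<noteq> {}" by metis
  then show "\<exists>g. \<forall>F\<in>\<F>. \<exists>n. F \<inter> C n \<inter> {n..<g n} \<noteq> {}" unfolding K(1) by blast
qed

text \<open>Preimages of the closed pieces are closed and contain no finite set, as the ultrafilter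
  is free. Finite sets are dense, so the ultrafilter is meager, which separates it trivially from
  its complement.\<close>

lemma fsigma_preimage_free_ultrafilter:
  assumes u: "ultrafilter_on UNIV \<U>" "free_filter \<U>"
    and \<U>: "\<U> = {X. e ` X \<union> - range e \<in> \<F>}" and e: "inj e"
  shows "\<not> fsigma_in powerset_topology \<F>"
proof
  assume fs: "fsigma_in powerset_topology \<F>"
  have "\<F> \<noteq> {}" using filter_onD(2)[OF free_filter_UNIV[OF u(2)]] \<U> by blast
  then obtain K :: "nat \<Rightarrow> nat set set" where K: "\<F> = (\<Union>n. K n)" "\<And>n. closedin powerset_topology (K n)"
    using fsigma_in_powerset_topologyD[OF fs] by blast
  define L where "L n = {X. e ` X \<union> - range e \<in> K n}" for n
  have "nowhere_dense (L j)" for j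
    unfolding nowhere_dense_def
  proof (intro allI)
    fix X :: "nat set" and n :: nat
    define Y where "Y = X \<inter> {..<n}"
    have "Y \<notin> \<U>" using free_filter_mem_infinite[OF u(2), of Y] by (auto simp: Y_def)
    then have "e ` Y \<union> - range e \<in> - K j" using K(1) \<U> by blast
    moreover have "openin powerset_topology (- K j)"
      using K(2) by (simp add: closedin_def Compl_eq_Diff_UNIV)
    ultimately obtain m where m: "cylinder (e ` Y \<union> - range e) m \<subseteq> - K j"
      using openin_powerset_topology_cylinder by blast
    \<comment> \<open>By injectivity only finitely many \<open>i\<close> have
      \<open>e i < m\<close>, so a long enough cylinder around \<open>Y\<close> is mapped into one
      that avoids \<open>K j\<close>.\<close>
    have "finite (e -` {..<m})" using e by (simp add: finite_vimageI)
    then obtain p where p: "\<And>i. e i < m \<Longrightarrow> i < p"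
      using finite_nat_set_iff_bounded[of "e -` {..<m}"] by auto
    have "e ` Z \<union> - range e \<in> cylinder (e ` Y \<union> - range e) m" if "Z \<in> cylinder Y (max n p)" for Z
    proof -
      have "i \<in> Z \<longleftrightarrow> i \<in> Y" if "e i < m" for i
        using \<open>Z \<in> cylinder Y (max n p)\<close> p[OF that] by (simp add: cylinder_def)
      then show ?thesis by (auto simp: cylinder_def)
    qed
    then have "cylinder Y (max n p) \<inter> L j = {}" using m by (auto simp: L_def)
    moreover have "Y \<in> cylinder X n" by (auto simp: Y_def cylinder_def)
    ultimately show "\<exists>Y\<in>cylinder X n. \<exists>m\<ge>n. cylinder Y m \<inter> L j = {}" by (meson max.cobounded1)
  qed
  then have "meager (\<Union>j. L j)" by (intro meager_UN nowhere_dense_imp_meager) auto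
  moreover have "\<U> = (\<Union>j. L j)" unfolding \<U> L_def K(1) by blast
  ultimately have "meager (\<U> \<inter> cylinder X n)" for X n by (metis Int_lower1 meager_subset)
  then have "category_separated \<U> (- \<U>)"
    unfolding category_separated_def by (meson order_refl self_in_cylinder)
  then show False using free_ultrafilter_not_category_separated[OF u] by blast
qed

text \<open>Taking preimages under \<open>e\<close> acts coordinatewise, so a continuous
  parametrization of the filter would give one of the ultrafilter.\<close>

lemma analytic_image_free_ultrafilter:
  assumes u: "ultrafilter_on UNIV \<U>" "free_filter \<U>" and \<U>: "\<U> = (\<lambda>F. e -` F) ` \<F>"
  shows "\<not> analytic_in powerset_topology \<F>"
proof
  assume "analytic_in powerset_topology \<F>"
  moreover have "\<F> \<noteq> {}" using filter_onD(2)[OF free_filter_UNIV[OF u(2)]] \<U> by blast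
  ultimately obtain h :: "(nat \<Rightarrow> nat) \<Rightarrow> nat set" where h: "\<F> = range h"
    "\<And>x k. \<exists>n. \<forall>y. (\<forall>i<n. y i = x i) \<longrightarrow> (k \<in> h y \<longleftrightarrow> k \<in> h x)"
    using analytic_in_powerset_topologyD[of \<F>] by blast
  have "\<U> \<noteq> range (\<lambda>x. e -` h x)"
    using h(2) by (intro free_ultrafilter_not_continuous_image[OF u]) simp
  then show False using \<U> h(1) by (simp add: image_image)
qed

section \<open>Derivation of the four claims from the trace ultrafilter\<close>

theorem theorem4:
  fixes \<F> :: "nat set set"
  assumes "free_filter \<F>"
    and "\<exists>x :: nat \<Rightarrow> nat set set. inj x \<and> filter_convergent \<F> beta_omega x"
  shows "(P_plus_filter \<F> \<longrightarrow> (\<exists>A \<in> positive_sets \<F>. ultrafilter_on A (filter_trace \<F> A))) \<and>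
    cmin dominating_number ultrafilter_number \<le>o character \<F> \<and>
    \<not> (analytic_in powerset_topology \<F> \<and> P_plus_filter \<F>) \<and>
    \<not> fsigma_in powerset_topology \<F>"
proof -
  note F = assms(1)
  have trace: "\<exists>A \<in> positive_sets \<F>. ultrafilter_on A (filter_trace \<F> A)" if "P_plus_filter \<F>"
    using P_plus_filter_trace_ultrafilter[OF F that] assms(2) by blast
  \<comment> \<open>The last three claims either assume \<open>P_plus_filter\<close> or derive it,
    so one elimination rule supplies the copied ultrafilter to all of them.\<close>
  have transfer: thesis if "P_plus_filter \<F>"
    "\<And>e \<U>. inj e \<Longrightarrow> ultrafilter_on UNIV \<U> \<Longrightarrow> free_filter \<U> \<Longrightarrow> \<U> = (\<lambda>F. e -` F) ` \<F> \<Longrightarrow>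
      \<U> = {X. e ` X \<union> - range e \<in> \<F>} \<Longrightarrow> thesis" for thesis
    using trace[OF that(1)] trace_ultrafilter_transfer[OF F] that(2) by metis
  have "dominating_number \<le>o character \<F> \<or> ultrafilter_number \<le>o character \<F>"
  proof (rule disjCI)
    assume "\<not> ultrafilter_number \<le>o character \<F>"
    obtain \<B> where \<B>: "filter_base \<B> \<F>" "character \<F> = |\<B>|"
      using character(1)[OF free_filter_UNIV[OF F]] by blast
    show "dominating_number \<le>o character \<F>"
    proof (rule ccontr)
      assume "\<not> ?thesis"
      \<comment> \<open>A small base makes the trace argument available; the copied ultrafilter has
        a base no larger, against the assumption on \<open>ultrafilter_number\<close>.\<close>
      then have "P_plus_filter \<F>"
        using P_plus_filter_if_base_less_dominating[OF F \<B>(1)] \<B>(2) by simp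
      then show False
      proof (rule transfer)
        fix e \<U>
        assume u: "ultrafilter_on UNIV \<U>" "free_filter \<U>" and \<U>: "\<U> = (\<lambda>F. e -` F) ` \<F>"
        note fU = free_filter_UNIV[OF u(2)]
        have "ultrafilter_number \<le>o character \<U>" by (rule ultrafilter_number(2)[OF u])
        also have "character \<U> \<le>o |(\<lambda>F. e -` F) ` \<B>|"
          by (rule character(2)[OF fU filter_base_image_vimage[OF \<B>(1) \<U> fU]])
        also have "|(\<lambda>F. e -` F) ` \<B>| \<le>o character \<F>" unfolding \<B>(2) by (rule card_of_image)
        finally show False using \<open>\<not> ultrafilter_number \<le>o character \<F>\<close> by blast
      qed
    qed
  qed
  then have "cmin dominating_number ultrafilter_number \<le>o character \<F>"
    by (simp add: cmin_ordLeq_iff[OF dominating_number(3) ultrafilter_number(3)])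
  moreover have "\<not> (analytic_in powerset_topology \<F> \<and> P_plus_filter \<F>)"
    using transfer analytic_image_free_ultrafilter by metis
  moreover have "\<not> fsigma_in powerset_topology \<F>"
    using transfer P_plus_filter_if_fsigma[OF F] fsigma_preimage_free_ultrafilter by metis
  ultimately show ?thesis using trace by blast
qed

end
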